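(* Let $a,b\in\mathbb{R}$, let $F$, $L$ be the generalized Fibonacci and Lucas numbers with parameters $a,b$ (defined in the context), let $(r(n))_{n\ge 0}$ be any sequence of real numbers, and put $p(n)=\sum_{i=0}^n r(i)\,r(n-i)$. Then for all $k,m\in\mathbb{N}$ and all integers $n\ge 0$, $$p(n)\,F(kn+2m)=\sum_{i=0}^n r(i)\,L(ki+m)\,r(n-i)\,F(k(n-i)+m).$$
   Context: For fixed real $a,b$, the generalized Fibonacci numbers are defined for all integers $n$ by $F(n)=0$ for $n\le 0$, $F(1)=1$, and $F(n)=aF(n-1)+bF(n-2)$ for $n>1$. The generalized Lucas numbers are defined for $n\ge 0$ by $\sum_{n\ge 0}L(n)x^n=\frac{2-ax}{1-ax-bx^2}$, i.e. $L(0)=2$ and $L(n)=F(n+1)+bF(n-1)$ for $n\ge 1$. *)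

theory Defs
  imports Complex_Main "HOL-Computational_Algebra.Formal_Power_Series"
begin

function gen_fib :: "real \<Rightarrow> real \<Rightarrow> int \<Rightarrow> real" where
  "gen_fib a b n =
     (if n \<le> 0 then 0
      else if n = 1 then 1
      else a * gen_fib a b (n - 1) + b * gen_fib a b (n - 2))"
  by auto
termination
  by (relation "measure (\<lambda>(a, b, n). nat n)") auto

declare gen_fib.simps [simp del]

definition gen_lucas_fps :: "real \<Rightarrow> real \<Rightarrow> real fps" where
  "gen_lucas_fps a b =
     (2 - fps_const a * fps_X) / (1 - fps_const a * fps_X - fps_const b * fps_X ^ 2)"

definition gen_lucas :: "real \<Rightarrow> real \<Rightarrow> nat \<Rightarrow> real" where
  "gen_lucas a b n = fps_nth (gen_lucas_fps a b) n"

lemma gen_fib_nonpos [simp]: "n \<le> 0 \<Longrightarrow> gen_fib a b n = 0"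
  by (simp add: gen_fib.simps)

lemma gen_fib_one [simp]: "gen_fib a b 1 = 1"
  by (simp add: gen_fib.simps)

lemma gen_fib_rec: "n > 1 \<Longrightarrow> gen_fib a b n = a * gen_fib a b (n - 1) + b * gen_fib a b (n - 2)"
  by (subst gen_fib.simps) simp

lemma gen_lucas_fps_mult:
  "gen_lucas_fps a b * (1 - fps_const a * fps_X - fps_const b * fps_X ^ 2) = 2 - fps_const a * fps_X"
proof -
  have "fps_nth (1 - fps_const a * fps_X - fps_const b * fps_X ^ 2) 0 \<noteq> 0"
    by (simp add: power2_eq_square)
  then show ?thesis
    unfolding gen_lucas_fps_def
    by (simp add: fps_divide_unit inverse_mult_eq_1 mult.assoc)
qed

lemma gen_lucas_nth:
  "gen_lucas a b n - a * (if n = 0 then 0 else gen_lucas a b (n - 1))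
     - b * (if n < 2 then 0 else gen_lucas a b (n - 2))
   = (if n = 0 then 2 else if n = 1 then - a else 0)"
proof -
  let ?G = "gen_lucas_fps a b"
  have "?G * (1 - fps_const a * fps_X - fps_const b * fps_X ^ 2)
      = ?G - fps_const a * (?G * fps_X) - fps_const b * (?G * fps_X ^ 2)"
    by (simp add: algebra_simps)
  then have "fps_nth (?G - fps_const a * (?G * fps_X) - fps_const b * (?G * fps_X ^ 2)) n
      = fps_nth (2 - fps_const a * fps_X) n"
    by (simp add: gen_lucas_fps_mult)
  then show ?thesis
    by (cases "n = 0"; cases "n = 1")
       (simp_all add: gen_lucas_def fps_X_power_mult_right_nth fps_numeral_nth)
qed

lemma gen_lucas_0: "gen_lucas a b 0 = 2"
  using gen_lucas_nth[of a b 0] by simp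

lemma gen_lucas_1: "gen_lucas a b 1 = a"
  using gen_lucas_nth[of a b 1] by (simp add: gen_lucas_0)

lemma gen_lucas_rec:
  "gen_lucas a b (Suc (Suc n)) = a * gen_lucas a b (Suc n) + b * gen_lucas a b n"
  using gen_lucas_nth[of a b "Suc (Suc n)"] by simp

lemma gen_lucas_eq_gen_fib:
  "n \<ge> 1 \<Longrightarrow> gen_lucas a b n = gen_fib a b (int n + 1) + b * gen_fib a b (int n - 1)"
proof (induction n rule: less_induct)
  case (less n)
  consider "n = 1" | "n = 2" | l where "n = Suc (Suc l)" "l \<ge> 1"
    using less.prems by (cases n; cases "n - 1") fastforce+
  then show ?case
  proof cases
    case 1
    then show ?thesis using gen_lucas_1[of a b] gen_fib_rec[of 2 a b] by simp
  next
    case 2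
    then show ?thesis
      using gen_lucas_rec[of a b 0] gen_lucas_1[of a b] gen_lucas_0[of a b]
        gen_fib_rec[of 2 a b] gen_fib_rec[of 3 a b]
      by (simp add: numeral_2_eq_2)
  next
    case 3
    have "gen_fib a b (int n + 1) = a * gen_fib a b (int n) + b * gen_fib a b (int n - 1)"
      and "gen_fib a b (int n - 1) = a * gen_fib a b (int n - 2) + b * gen_fib a b (int n - 3)"
      using gen_fib_rec[of "int n + 1" a b] gen_fib_rec[of "int n - 1" a b] 3 by simp_all
    moreover have "gen_lucas a b (Suc l) = gen_fib a b (int n) + b * gen_fib a b (int n - 2)"
      and "gen_lucas a b l = gen_fib a b (int n - 1) + b * gen_fib a b (int n - 3)"
      using less.IH[of "Suc l"] less.IH[of l] 3 by (simp_all add: algebra_simps)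
    ultimately show ?thesis
      using 3(1) gen_lucas_rec[of a b l] by (simp add: algebra_simps)
  qed
qed

end

theory Submission
  imports Defs
begin

text \<open>
  The classical identity \<open>L s * F t + L t * F s = 2 * F (s + t)\<close> shows that adding the
  right-hand sum to its reflection under \<open>i \<mapsto> n - i\<close> makes the Fibonacci and Lucas factors
  collapse to the constant \<open>2 * F (k * n + 2 * m)\<close>, leaving the convolution of \<open>r\<close> with itself.
\<close>

text \<open>Natural indices keep the recurrence free of side conditions. Over the integers it fails
  at index 1, because \<open>gen_fib\<close> is cut off to 0 at all indices up to 0.\<close>

lemma gen_fib_Suc_Suc:
  "gen_fib a b (int (Suc (Suc n))) = a * gen_fib a b (int (Suc n)) + b * gen_fib a b (int n)"
  using gen_fib_rec[of "int (Suc (Suc n))" a b] by simp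

text \<open>This is the case \<open>t = 1\<close> of the addition formula below, whose induction
  needs it as second base case. Both sides obey the same second-order linear recurrence in
  \<open>s\<close> and agree at 0 and 1.\<close>

lemma gen_lucas_plus_gen_fib:
  "gen_lucas a b s + a * gen_fib a b (int s) = 2 * gen_fib a b (int (Suc s))"
proof (induction s rule: induct_nat_012)
  case 0
  show ?case by (simp add: gen_lucas_0)
next
  case 1
  show ?case
    using gen_fib_Suc_Suc[of a b 0] gen_lucas_1[of a b] by simp
next
  case (ge2 s)
  have "gen_lucas a b (Suc (Suc s)) + a * gen_fib a b (int (Suc (Suc s)))
      = a * (gen_lucas a b (Suc s) + a * gen_fib a b (int (Suc s)))
        + b * (gen_lucas a b s + a * gen_fib a b (int s))"
    by (simp only: gen_lucas_rec gen_fib_Suc_Suc) (simp only: algebra_simps)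
  also have "\<dots> = 2 * gen_fib a b (int (Suc (Suc (Suc s))))"
    unfolding ge2.IH gen_fib_Suc_Suc[of a b "Suc s"] by (simp only: algebra_simps)
  finally show ?case .
qed

text \<open>For fixed \<open>s\<close>, both sides are solutions in \<open>t\<close> of the
  recurrence with coefficients \<open>a\<close> and \<open>b\<close>, so agreement at
  \<open>t = 0\<close> and \<open>t = 1\<close> suffices.\<close>

lemma gen_lucas_gen_fib_add:
  "gen_lucas a b s * gen_fib a b (int t) + gen_lucas a b t * gen_fib a b (int s)
     = 2 * gen_fib a b (int (s + t))"
proof (induction t rule: induct_nat_012)
  case 0
  show ?case by (simp add: gen_lucas_0)
next
  case 1
  show ?case
    using gen_lucas_plus_gen_fib[of a b s] gen_lucas_1[of a b] by simp
next
  case (ge2 t)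
  have "gen_lucas a b s * gen_fib a b (int (Suc (Suc t)))
        + gen_lucas a b (Suc (Suc t)) * gen_fib a b (int s)
      = a * (gen_lucas a b s * gen_fib a b (int (Suc t))
             + gen_lucas a b (Suc t) * gen_fib a b (int s))
        + b * (gen_lucas a b s * gen_fib a b (int t) + gen_lucas a b t * gen_fib a b (int s))"
    by (simp only: gen_lucas_rec gen_fib_Suc_Suc) (simp only: algebra_simps)
  also have "\<dots> = 2 * gen_fib a b (int (s + Suc (Suc t)))"
    unfolding ge2.IH add_Suc_right gen_fib_Suc_Suc by (simp only: algebra_simps)
  finally show ?case .
qed

theorem theorem5:
  fixes a b :: real and r p :: "nat \<Rightarrow> real"
  assumes p: "\<And>n. p n = (\<Sum>i=0..n. r i * r (n - i))"
  shows "\<forall>(k::nat) (m::nat) (n::nat).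
    p n * gen_fib a b (int (k * n + 2 * m)) =
    (\<Sum>i=0..n. r i * gen_lucas a b (k * i + m) * r (n - i) * gen_fib a b (int (k * (n - i) + m)))"
proof (intro allI)
  fix k m n :: nat
  define F where "F t = gen_fib a b (int t)" for t
  define L where "L = gen_lucas a b"
  define S where "S = (\<Sum>i=0..n. r i * L (k * i + m) * r (n - i) * F (k * (n - i) + m))"
  have "S = (\<Sum>i=0..n. r (n - i) * L (k * (n - i) + m) * r i * F (k * i + m))"
    unfolding S_def by (subst sum.atLeastAtMost_rev) (rule sum.cong, auto)
  then have "2 * S = (\<Sum>i=0..n. r i * L (k * i + m) * r (n - i) * F (k * (n - i) + m))
      + (\<Sum>i=0..n. r (n - i) * L (k * (n - i) + m) * r i * F (k * i + m))"
    using S_def by linarith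
  also have "\<dots> = (\<Sum>i=0..n. r i * r (n - i) * (2 * F (k * n + 2 * m)))"
    unfolding sum.distrib[symmetric]
  proof (rule sum.cong[OF refl])
    fix i assume "i \<in> {0..n}"
    \<comment> \<open>Writing \<open>n\<close> as \<open>i + j\<close> removes the truncated
      subtraction, so the two indices visibly have a sum independent of \<open>i\<close>.\<close>
    then obtain j where "n = i + j"
      by (auto simp: le_iff_add)
    then have "k * i + m + (k * (n - i) + m) = k * n + 2 * m"
      by (simp add: algebra_simps)
    then have "L (k * i + m) * F (k * (n - i) + m) + L (k * (n - i) + m) * F (k * i + m)
        = 2 * F (k * n + 2 * m)"
      unfolding L_def F_def using gen_lucas_gen_fib_add by metis
    then show "r i * L (k * i + m) * r (n - i) * F (k * (n - i) + m)
        + r (n - i) * L (k * (n - i) + m) * r i * F (k * i + m)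
        = r i * r (n - i) * (2 * F (k * n + 2 * m))"
      by algebra
  qed
  also have "\<dots> = 2 * (p n * F (k * n + 2 * m))"
    by (simp add: p sum_distrib_right mult_ac sum_distrib_left)
  \<comment> \<open>Both sides have been computed doubled; cancelling the factor 2 gives the
    claim.\<close>
  finally show "p n * gen_fib a b (int (k * n + 2 * m)) =
    (\<Sum>i=0..n. r i * gen_lucas a b (k * i + m) * r (n - i) * gen_fib a b (int (k * (n - i) + m)))"
    unfolding S_def L_def F_def by simp
qed

end
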